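(* Let $S$ be a reduced information semialgebra. 1. The following statements are equivalent. (a) $U_n(S)$ is atomic for every integer $n\ge 2$. (b) $U_n(S)$ is atomic for some integer $n\ge 2$. (c) $(S,+)$ is atomic. 2. The following statements are equivalent. (a) $T_n(S)^\bullet$ is atomic for every integer $n\ge 2$. (b) $T_n(S)^\bullet$ is atomic for some integer $n\ge 2$. (c) $S$ is bi-atomic, i.e. both $(S,+)$ and $(S^\bullet,\cdot)$ are atomic.
   Context: All monoids are cancellative but not necessarily commutative. An information semialgebra is a semiring $S$ with $0$ and $1$ (so $(S,+)$ is a commutative monoid with identity $0$, multiplication has identity $1$ and distributes over addition, and $0\cdot x=0$ for all $x$) such that $(S,+)$ is a cancellative commutative monoid whose only invertible element is $0$, and $(S\setminus\{0\},\cdot)$ is a cancellative commutative monoid. Write $S^\bullet=S\setminus\{0\}$. $S$ is reduced if $1$ is the only invertible element of $(S^\bullet,\cdot)$. $T_n(S)$ is the semiring of $n\times n$ upper triangular matrices over $S$. $T_n(S)^\bullet$ is the multiplicative monoid of cancellable elements of $T_n(S)$, i.e. of the upper triangular matrices all of whose diagonal entries are nonzero. $U_n(S)$ is its submonoid of matrices all of whose diagonal entries equal $1$. In a monoid $M$, an atom is a non-invertible $a$ such that $a=uv$ implies that $u$ or $v$ is invertible; $M$ is atomic if each non-invertible element is a finite product of atoms. *)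

theory Defs
  imports "Jordan_Normal_Form.Matrix"
begin

text \<open>Atoms are defined directly, since \<open>irreducible\<close> from HOL-Algebra is based on
  one-sided divisibility, which is not the right notion in a noncommutative monoid.\<close>

definition monoid_atom :: "('a, 'b) monoid_scheme \<Rightarrow> 'a \<Rightarrow> bool" where
  "monoid_atom M a \<longleftrightarrow> a \<in> carrier M \<and> a \<notin> Units M \<and>
     (\<forall>u\<in>carrier M. \<forall>v\<in>carrier M. a = u \<otimes>\<^bsub>M\<^esub> v \<longrightarrow> u \<in> Units M \<or> v \<in> Units M)"

definition atomic_monoid :: "('a, 'b) monoid_scheme \<Rightarrow> bool" where
  "atomic_monoid M \<longleftrightarrow>
     (\<forall>x\<in>carrier M - Units M. \<exists>as. (\<forall>a\<in>set as. monoid_atom M a) \<and> x = foldr (\<otimes>\<^bsub>M\<^esub>) as \<one>\<^bsub>M\<^esub>)"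

definition cancellable :: "('a, 'b) monoid_scheme \<Rightarrow> 'a \<Rightarrow> bool" where
  "cancellable M a \<longleftrightarrow> a \<in> carrier M \<and>
     (\<forall>x\<in>carrier M. \<forall>y\<in>carrier M. a \<otimes>\<^bsub>M\<^esub> x = a \<otimes>\<^bsub>M\<^esub> y \<longrightarrow> x = y) \<and>
     (\<forall>x\<in>carrier M. \<forall>y\<in>carrier M. x \<otimes>\<^bsub>M\<^esub> a = y \<otimes>\<^bsub>M\<^esub> a \<longrightarrow> x = y)"

text \<open>The class \<open>semiring_no_zero_divisors_cancel\<close> says that the nonzero elements are closed
  under multiplication and that nonzero factors can be cancelled. Commutativity of
  multiplication and \<open>x * 0 = 0\<close> may be taken as part of \<open>comm_semiring_1\<close>: the former is
  required for nonzero \<open>x\<close> and \<open>y\<close>, and \<open>x * 0 + x * 0 = x * 0\<close> gives the latter by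
  additive cancellation. The class \<open>cancel_semigroup_add\<close>, unlike \<open>cancel_comm_monoid_add\<close>,
  does not introduce a subtraction.\<close>

class information_semialgebra =
  comm_semiring_1 + cancel_semigroup_add + semiring_no_zero_divisors_cancel +
  assumes add_invertible_imp_zero: "a + b = 0 \<Longrightarrow> a = 0"

definition additive_monoid :: "'a::information_semialgebra monoid" where
  "additive_monoid = \<lparr>carrier = UNIV, mult = (+), one = 0\<rparr>"

definition nonzero_monoid :: "'a::information_semialgebra monoid" where
  "nonzero_monoid = \<lparr>carrier = UNIV - {0}, mult = (*), one = 1\<rparr>"

definition reduced_semialgebra :: "'a::information_semialgebra itself \<Rightarrow> bool" where
  "reduced_semialgebra _ \<longleftrightarrow> Units (nonzero_monoid :: 'a monoid) = {1}"

definition bi_atomic :: "'a::information_semialgebra itself \<Rightarrow> bool" where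
  "bi_atomic _ \<longleftrightarrow>
     atomic_monoid (additive_monoid :: 'a monoid) \<and> atomic_monoid (nonzero_monoid :: 'a monoid)"

lemma comm_monoid_additive: "comm_monoid (additive_monoid :: 'a::information_semialgebra monoid)"
  by unfold_locales (auto simp: additive_monoid_def ac_simps)

lemma comm_monoid_nonzero: "comm_monoid (nonzero_monoid :: 'a::information_semialgebra monoid)"
  by unfold_locales (auto simp: nonzero_monoid_def ac_simps)

definition triangular_monoid :: "nat \<Rightarrow> 'a::information_semialgebra mat monoid" where
  "triangular_monoid n =
     \<lparr>carrier = {A \<in> carrier_mat n n. upper_triangular A}, mult = (*), one = 1\<^sub>m n\<rparr>"

definition triangular_bullet :: "nat \<Rightarrow> 'a::information_semialgebra mat monoid" where
  "triangular_bullet n =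
     triangular_monoid n \<lparr>carrier := {A. cancellable (triangular_monoid n) A}\<rparr>"

definition unitriangular_monoid :: "nat \<Rightarrow> 'a::information_semialgebra mat monoid" where
  "unitriangular_monoid n =
     triangular_bullet n
       \<lparr>carrier := {A \<in> carrier (triangular_bullet n). \<forall>i<n. A $$ (i, i) = 1}\<rparr>"

lemma triangular_mult_index:
  assumes "A \<in> carrier_mat n n" "B \<in> carrier_mat n n" "i < n" "j < n"
  shows "(A * B) $$ (i, j) = (\<Sum>k<n. A $$ (i, k) * B $$ (k, j))"
  using assms by (auto simp: scalar_prod_def atLeast0LessThan intro!: sum.cong)

lemma upper_triangular_mult:
  fixes A B :: "'a::semiring_0 mat"
  assumes A: "A \<in> carrier_mat n n" "upper_triangular A"
    and B: "B \<in> carrier_mat n n" "upper_triangular B"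
  shows "upper_triangular (A * B)"
proof (rule upper_triangularI)
  fix i j assume ij: "j < i" "i < dim_row (A * B)"
  have "A $$ (i, k) * B $$ (k, j) = 0" if "k < n" for k
    using ij that A B by (cases "k < i") (auto simp: upper_triangularD)
  then show "(A * B) $$ (i, j) = 0"
    using ij A B by (subst triangular_mult_index[of _ n]) auto
qed

lemma monoid_triangular: "monoid (triangular_monoid n :: 'a::information_semialgebra mat monoid)"
  by unfold_locales
     (auto simp: triangular_monoid_def upper_triangular_mult assoc_mult_mat[of _ n n _ n _ n])

text \<open>Back substitution: a triangular system whose last diagonal coefficient vanishes does not
  determine its unknowns. As there is no subtraction, solutions come as pairs \<open>(p, q)\<close>.\<close>

lemma back_substitution:
  fixes f :: "nat \<Rightarrow> nat \<Rightarrow> 'a::information_semialgebra"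
  assumes tri: "\<And>r k. k < r \<Longrightarrow> f r k = 0"
    and nz: "\<And>k. k < i \<Longrightarrow> f k k \<noteq> 0" and z: "f i i = 0"
  shows "m \<le> i \<Longrightarrow> \<exists>p q. p i \<noteq> q i \<and> (\<forall>k. k < i - m \<or> i < k \<longrightarrow> p k = 0 \<and> q k = 0) \<and>
      (\<forall>r\<ge>i - m. (\<Sum>k\<le>i. f r k * p k) = (\<Sum>k\<le>i. f r k * q k))"
proof (induction m)
  case 0
  have "(\<Sum>k\<le>i. f r k * (if k = i then 1 else 0)) = 0" if "r \<ge> i" for r
    using that z tri[of i r] by (cases "r = i") (auto simp: if_distrib[of "\<lambda>x. _ * x"] cong: if_cong)
  then show ?case
    by (intro exI[of _ "\<lambda>k. if k = i then 1 else 0"] exI[of _ "\<lambda>k. 0"]) auto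
next
  case (Suc m)
  then obtain p q where pq: "p i \<noteq> q i"
      "\<And>k. k < i - m \<or> i < k \<Longrightarrow> p k = 0 \<and> q k = 0"
      "\<And>r. r \<ge> i - m \<Longrightarrow> (\<Sum>k\<le>i. f r k * p k) = (\<Sum>k\<le>i. f r k * q k)"
    by auto
  define l where "l = i - Suc m"
  have l: "l < i" "l < i - m" "\<And>r. r \<ge> l \<Longrightarrow> r = l \<or> r \<ge> i - m"
    using Suc.prems by (auto simp: l_def)
  define c where "c = f l l"
  have c: "c \<noteq> 0" using nz l(1) by (simp add: c_def)
  define P where "P = (\<Sum>k\<le>i. f l k * p k)"
  define Q where "Q = (\<Sum>k\<le>i. f l k * q k)"
  have upd: "(\<Sum>k\<le>i. f r k * (if k = l then x else c * g k)) = f r l * x + c * (\<Sum>k\<le>i. f r k * g k)"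
    if "g l = 0" for g r x
  proof -
    have "(\<Sum>k\<le>i. f r k * (if k = l then x else c * g k))
        = (\<Sum>k\<le>i. (if k = l then f r l * x else 0) + c * (f r k * g k))"
      using that by (intro sum.cong) (auto simp: ac_simps)
    also have "\<dots> = f r l * x + c * (\<Sum>k\<le>i. f r k * g k)"
      using l(1) by (simp add: sum.distrib sum_distrib_left)
    finally show ?thesis .
  qed
  have pl: "p l = 0" "q l = 0" using pq(2)[of l] l by auto
  show ?case
  proof (intro exI conjI)
    show "(if i = l then Q else c * p i) \<noteq> (if i = l then P else c * q i)"
      using pq(1) c l by auto
    show "\<forall>k. k < i - Suc m \<or> i < k \<longrightarrow> (if k = l then Q else c * p k) = 0 \<and>
        (if k = l then P else c * q k) = 0"
      using pq(2) l by (auto simp: l_def)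
    show "\<forall>r\<ge>i - Suc m. (\<Sum>k\<le>i. f r k * (if k = l then Q else c * p k)) =
        (\<Sum>k\<le>i. f r k * (if k = l then P else c * q k))"
    proof (intro allI impI)
      fix r assume "r \<ge> i - Suc m"
      then consider "r = l" | "r \<ge> i - m" "l < r" using l by (auto simp: l_def)
      then show "(\<Sum>k\<le>i. f r k * (if k = l then Q else c * p k)) =
          (\<Sum>k\<le>i. f r k * (if k = l then P else c * q k))"
      proof cases
        case 1
        then show ?thesis
          by (simp add: upd[of p] upd[of q] pl P_def[symmetric] Q_def[symmetric]
              c_def[symmetric] add.commute)
      next
        case 2
        then show ?thesis using pq(3)[of r] tri[of l r] by (simp add: upd[of p] upd[of q] pl)
      qed
    qed
  qed
qed

lemma cancellable_triangular_iff:
  fixes A :: "'a::information_semialgebra mat"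
  shows "cancellable (triangular_monoid n) A \<longleftrightarrow>
    A \<in> carrier_mat n n \<and> upper_triangular A \<and> (\<forall>i<n. A $$ (i, i) \<noteq> 0)" (is "?L \<longleftrightarrow> ?R")
proof
  assume R: ?R
  then have A: "A \<in> carrier_mat n n" and tri: "\<And>i j. j < i \<Longrightarrow> i < n \<Longrightarrow> A $$ (i, j) = 0"
    and nz: "\<And>i. i < n \<Longrightarrow> A $$ (i, i) \<noteq> 0" by auto
  have left: "X = Y" if X: "X \<in> carrier_mat n n" and Y: "Y \<in> carrier_mat n n"
    and eq: "A * X = A * Y" for X Y
  proof -
    have "i < n \<Longrightarrow> j < n \<Longrightarrow> X $$ (i, j) = Y $$ (i, j)" for i j
    proof (induction "n - i" arbitrary: i rule: less_induct)
      case less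
      have rest: "A $$ (i, k) * X $$ (k, j) = A $$ (i, k) * Y $$ (k, j)"
        if "k \<in> {..<n} - {i}" for k
        using less that tri[of k i] by (cases "k < i") auto
      have "(A * X) $$ (i, j) = (A * Y) $$ (i, j)" by (simp add: eq)
      then have "A $$ (i, i) * X $$ (i, j) + (\<Sum>k\<in>{..<n} - {i}. A $$ (i, k) * X $$ (k, j)) =
          A $$ (i, i) * Y $$ (i, j) + (\<Sum>k\<in>{..<n} - {i}. A $$ (i, k) * Y $$ (k, j))"
        using less.prems by (simp add: triangular_mult_index[OF A X] triangular_mult_index[OF A Y]
            sum.remove[of "{..<n}" i] del: index_mult_mat)
      moreover have "(\<Sum>k\<in>{..<n} - {i}. A $$ (i, k) * X $$ (k, j)) =
          (\<Sum>k\<in>{..<n} - {i}. A $$ (i, k) * Y $$ (k, j))"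
        by (rule sum.cong[OF refl rest])
      ultimately show ?case using nz[OF less.prems(1)] by simp
    qed
    then show ?thesis using X Y by (intro eq_matI) auto
  qed
  have right: "X = Y" if X: "X \<in> carrier_mat n n" and Y: "Y \<in> carrier_mat n n"
    and eq: "X * A = Y * A" for X Y
  proof -
    have "i < n \<Longrightarrow> j < n \<Longrightarrow> X $$ (i, j) = Y $$ (i, j)" for i j
    proof (induction j rule: less_induct)
      case (less j)
      have rest: "X $$ (i, k) * A $$ (k, j) = Y $$ (i, k) * A $$ (k, j)"
        if "k \<in> {..<n} - {j}" for k
        using less that tri[of j k] by (cases "k < j") auto
      have "(X * A) $$ (i, j) = (Y * A) $$ (i, j)" by (simp add: eq)
      then have "X $$ (i, j) * A $$ (j, j) + (\<Sum>k\<in>{..<n} - {j}. X $$ (i, k) * A $$ (k, j)) =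
          Y $$ (i, j) * A $$ (j, j) + (\<Sum>k\<in>{..<n} - {j}. Y $$ (i, k) * A $$ (k, j))"
        using less.prems by (simp add: triangular_mult_index[OF X A] triangular_mult_index[OF Y A]
            sum.remove[of "{..<n}" j] del: index_mult_mat)
      moreover have "(\<Sum>k\<in>{..<n} - {j}. X $$ (i, k) * A $$ (k, j)) =
          (\<Sum>k\<in>{..<n} - {j}. Y $$ (i, k) * A $$ (k, j))"
        by (rule sum.cong[OF refl rest])
      ultimately show ?case using nz[OF less.prems(2)] by simp
    qed
    then show ?thesis using X Y by (intro eq_matI) auto
  qed
  show ?L
    unfolding cancellable_def using R left right by (auto simp: triangular_monoid_def)
next
  assume L: ?L
  then have A: "A \<in> carrier_mat n n" "upper_triangular A"
    by (auto simp: cancellable_def triangular_monoid_def)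
  have canc: "X = Y" if "X \<in> carrier_mat n n" "upper_triangular X"
    "Y \<in> carrier_mat n n" "upper_triangular Y" "A * X = A * Y" for X Y
    using L that unfolding cancellable_def triangular_monoid_def by auto
  have "\<forall>i<n. A $$ (i, i) \<noteq> 0"
  proof (rule ccontr)
    assume "\<not> ?thesis"
    then obtain i where i: "i < n" "A $$ (i, i) = 0"
      and least: "\<And>k. k < i \<Longrightarrow> \<not> (k < n \<and> A $$ (k, k) = 0)"
      using exists_least_iff[of "\<lambda>i. i < n \<and> A $$ (i, i) = 0"] by auto
    define f where "f r k = (if k < r then 0 else A $$ (r, k))" for r k
    have fA: "f r k = A $$ (r, k)" if "r < n" for r k
      using that A by (auto simp: f_def)
    obtain p q where pq: "p i \<noteq> q i" "\<And>k. i < k \<Longrightarrow> p k = 0 \<and> q k = 0"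
      "\<And>r. (\<Sum>k\<le>i. f r k * p k) = (\<Sum>k\<le>i. f r k * q k)"
      using back_substitution[of f i i] i least by (force simp: f_def)
    define M where "M g = mat n n (\<lambda>(r, j). if j = i then g r else 0)" for g :: "nat \<Rightarrow> 'a"
    have M: "M g \<in> carrier_mat n n" for g by (simp add: M_def)
    have ut: "upper_triangular (M g)" if "\<And>k. i < k \<Longrightarrow> g k = 0" for g
      using that by (auto simp: M_def upper_triangular_def)
    have AM: "(A * M g) $$ (r, j) = (if j = i then \<Sum>k\<le>i. f r k * g k else 0)"
      if rj: "r < n" "j < n" and g: "\<And>k. i < k \<Longrightarrow> g k = 0" for g r j
    proof -
      have "(A * M g) $$ (r, j) = (\<Sum>k<n. if j = i then f r k * g k else 0)"
        using rj by (subst triangular_mult_index[OF A(1) M]) (auto simp: M_def fA intro!: sum.cong)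
      also have "\<dots> = (\<Sum>k\<le>i. if j = i then f r k * g k else 0)"
        using i g by (intro sum.mono_neutral_right) (auto simp: not_le)
      finally show ?thesis by simp
    qed
    have "A * M p = A * M q"
      using A M[of p] M[of q] pq
      by (intro eq_matI) (auto simp: AM simp del: index_mult_mat(1))
    then have "M p = M q"
      using canc[OF M ut M ut] pq(2) by blast
    then have "M p $$ (i, i) = M q $$ (i, i)" by simp
    then show False using pq(1) i by (simp add: M_def)
  qed
  with A show ?R by blast
qed

lemma carrier_triangular_bullet:
  "carrier (triangular_bullet n :: 'a::information_semialgebra mat monoid) =
     {A \<in> carrier_mat n n. upper_triangular A \<and> (\<forall>i<n. A $$ (i, i) \<noteq> 0)}"
  by (auto simp: triangular_bullet_def cancellable_triangular_iff)

lemma carrier_unitriangular_monoid: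
  "carrier (unitriangular_monoid n :: 'a::information_semialgebra mat monoid) =
     {A \<in> carrier_mat n n. upper_triangular A \<and> (\<forall>i<n. A $$ (i, i) = 1)}"
  by (auto simp: unitriangular_monoid_def carrier_triangular_bullet)

end

theory Submission
  imports Defs
begin

text \<open>Let \<open>E\<^bsub>ij\<^esub>(a)\<close> be the identity matrix with the entry at \<open>(i, j)\<close> replaced by \<open>a\<close>.
  Sums of elements of \<open>S\<close> vanish only if all summands do, and a product is \<open>1\<close> only if both
  factors are, so every factorization of \<open>E\<^bsub>ij\<^esub>(a)\<close> consists of matrices of the same shape.
  Hence \<open>a \<mapsto> E\<^bsub>ij\<^esub>(a)\<close> is a divisor-closed embedding of \<open>(S, +)\<close> (for \<open>i < j\<close>) or of
  \<open>(S\<^sup>\<bullet>, \<cdot>)\<close> (for \<open>i = j\<close>). Such an embedding preserves and reflects atoms, which gives the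
  necessity of the atomicity conditions. They are sufficient because each triangular matrix \<open>A\<close>
  is a product of the matrices \<open>E\<^bsub>ij\<^esub>(A\<^bsub>ij\<^esub>)\<close>, taken with \<open>j\<close> decreasing and, for equal \<open>j\<close>,
  with \<open>i\<close> decreasing from \<open>j\<close>.\<close>

section \<open>Products of atoms\<close>

definition atom_products :: "('a, 'b) monoid_scheme \<Rightarrow> 'a set" where
  "atom_products M = {foldr (\<otimes>\<^bsub>M\<^esub>) as \<one>\<^bsub>M\<^esub> |as. \<forall>a\<in>set as. monoid_atom M a}"

lemma atomic_monoid_iff: "atomic_monoid M \<longleftrightarrow> carrier M - Units M \<subseteq> atom_products M"
  unfolding atomic_monoid_def atom_products_def by blast

lemma one_in_atom_products: "\<one>\<^bsub>M\<^esub> \<in> atom_products M"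
  unfolding atom_products_def by (intro CollectI exI[of _ "[]"]) simp

lemma atom_products_Cons:
  assumes "monoid_atom M a" "x \<in> atom_products M"
  shows "a \<otimes>\<^bsub>M\<^esub> x \<in> atom_products M"
proof -
  obtain as where "x = foldr (\<otimes>\<^bsub>M\<^esub>) as \<one>\<^bsub>M\<^esub>" "\<forall>a\<in>set as. monoid_atom M a"
    using assms(2) unfolding atom_products_def by blast
  then show ?thesis
    using assms(1) unfolding atom_products_def by (intro CollectI exI[of _ "a # as"]) simp
qed

lemma atom_products_induct [consumes 1, case_names one Cons]:
  assumes "x \<in> atom_products M"
    and "P \<one>\<^bsub>M\<^esub>"
    and "\<And>a y. monoid_atom M a \<Longrightarrow> y \<in> atom_products M \<Longrightarrow> P y \<Longrightarrow> P (a \<otimes>\<^bsub>M\<^esub> y)"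
  shows "P x"
proof -
  obtain as where x: "x = foldr (\<otimes>\<^bsub>M\<^esub>) as \<one>\<^bsub>M\<^esub>" and "\<forall>a\<in>set as. monoid_atom M a"
    using assms(1) unfolding atom_products_def by blast
  from this(2) have "P (foldr (\<otimes>\<^bsub>M\<^esub>) as \<one>\<^bsub>M\<^esub>)"
  proof (induction as)
    case Nil
    then show ?case using assms(2) by simp
  next
    case (Cons a as)
    then show ?case using assms(3)[of a] by (auto simp: atom_products_def)
  qed
  then show ?thesis using x by simp
qed

lemma monoid_atom_carrier: "monoid_atom M a \<Longrightarrow> a \<in> carrier M"
  by (simp add: monoid_atom_def)

context monoid
begin

lemma atom_products_carrier: "x \<in> atom_products G \<Longrightarrow> x \<in> carrier G"
  by (induction rule: atom_products_induct) (auto dest: monoid_atom_carrier)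

lemma atom_products_mult:
  assumes "x \<in> atom_products G" "y \<in> atom_products G"
  shows "x \<otimes> y \<in> atom_products G"
  using assms
proof (induction rule: atom_products_induct)
  case one
  then show ?case by (simp add: atom_products_carrier)
next
  case (Cons a z)
  then have "a \<otimes> z \<otimes> y = a \<otimes> (z \<otimes> y)"
    by (simp add: m_assoc monoid_atom_carrier atom_products_carrier)
  then show ?case using Cons by (simp add: atom_products_Cons)
qed

text \<open>Atomicity says nothing about units; when \<open>\<one>\<close> is the only unit, the
  empty product covers it.\<close>

lemma atomic_imp_atom_products:
  "atomic_monoid G \<Longrightarrow> Units G = {\<one>} \<Longrightarrow> x \<in> carrier G \<Longrightarrow> x \<in> atom_products G"
  by (cases "x = \<one>") (auto simp: atomic_monoid_iff one_in_atom_products)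

end

section \<open>Divisor-closed embeddings\<close>

text \<open>Up to isomorphism, \<open>N\<close> is a divisor-closed submonoid of \<open>M\<close>.
  Factorizations into two factors suffice for \<open>divisors\<close>, since longer ones can be
  taken apart one factor at a time.\<close>

locale divisor_closed_embedding = N: monoid N + M: monoid M
  for N (structure) and M (structure) and f +
  assumes hom: "f \<in> hom N M"
    and map_one: "f \<one>\<^bsub>N\<^esub> = \<one>\<^bsub>M\<^esub>"
    and inj: "inj_on f (carrier N)"
    and divisors: "u \<in> carrier M \<Longrightarrow> v \<in> carrier M \<Longrightarrow> x \<in> carrier N \<Longrightarrow> u \<otimes>\<^bsub>M\<^esub> v = f x \<Longrightarrow>
      u \<in> f ` carrier N \<and> v \<in> f ` carrier N"
begin

lemma map_closed: "x \<in> carrier N \<Longrightarrow> f x \<in> carrier M"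
  using hom by (rule hom_in_carrier)

lemma map_mult: "x \<in> carrier N \<Longrightarrow> y \<in> carrier N \<Longrightarrow> f (x \<otimes>\<^bsub>N\<^esub> y) = f x \<otimes>\<^bsub>M\<^esub> f y"
  using hom by (rule hom_mult)

lemma map_eq_iff: "x \<in> carrier N \<Longrightarrow> y \<in> carrier N \<Longrightarrow> f x = f y \<longleftrightarrow> x = y"
  using inj by (rule inj_on_eq_iff)

text \<open>Both factors have preimages by \<open>divisors\<close>, and injectivity then lifts the
  equation itself to \<open>N\<close>.\<close>

lemma factorization:
  assumes "u \<in> carrier M" "v \<in> carrier M" "x \<in> carrier N" "f x = u \<otimes>\<^bsub>M\<^esub> v"
  obtains y z where "y \<in> carrier N" "z \<in> carrier N" "u = f y" "v = f z" "x = y \<otimes>\<^bsub>N\<^esub> z"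
proof -
  obtain y z where yz: "y \<in> carrier N" "z \<in> carrier N" "u = f y" "v = f z"
    using divisors[OF assms(1-3)] assms(4) by auto
  then have "x = y \<otimes>\<^bsub>N\<^esub> z" using assms by (simp add: map_eq_iff flip: map_mult)
  with yz show ?thesis by (rule that)
qed

text \<open>An inverse of \<open>f x\<close> is a factor of the image of one, so
  \<open>divisors\<close> places it in the image of \<open>f\<close>.\<close>

lemma Units_iff:
  assumes "x \<in> carrier N"
  shows "f x \<in> Units M \<longleftrightarrow> x \<in> Units N"
proof
  assume "f x \<in> Units M"
  then obtain u where u: "u \<in> carrier M" "u \<otimes>\<^bsub>M\<^esub> f x = \<one>\<^bsub>M\<^esub>" "f x \<otimes>\<^bsub>M\<^esub> u = \<one>\<^bsub>M\<^esub>"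
    unfolding Units_def by blast
  obtain y where y: "y \<in> carrier N" "u = f y"
    using divisors[of u "f x" "\<one>\<^bsub>N\<^esub>"] u assms by (auto simp: map_one map_closed)
  then have "y \<otimes>\<^bsub>N\<^esub> x = \<one>\<^bsub>N\<^esub>" "x \<otimes>\<^bsub>N\<^esub> y = \<one>\<^bsub>N\<^esub>"
    using u assms map_eq_iff[of "y \<otimes>\<^bsub>N\<^esub> x" "\<one>\<^bsub>N\<^esub>"] map_eq_iff[of "x \<otimes>\<^bsub>N\<^esub> y" "\<one>\<^bsub>N\<^esub>"]
    by (auto simp: map_one map_mult)
  then show "x \<in> Units N" using y assms unfolding Units_def by blast
next
  assume "x \<in> Units N"
  then obtain y where y: "y \<in> carrier N" "y \<otimes>\<^bsub>N\<^esub> x = \<one>\<^bsub>N\<^esub>" "x \<otimes>\<^bsub>N\<^esub> y = \<one>\<^bsub>N\<^esub>"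
    unfolding Units_def by blast
  then have "f y \<otimes>\<^bsub>M\<^esub> f x = \<one>\<^bsub>M\<^esub>" "f x \<otimes>\<^bsub>M\<^esub> f y = \<one>\<^bsub>M\<^esub>"
    using assms by (simp_all add: map_one flip: map_mult)
  then show "f x \<in> Units M" using y assms map_closed unfolding Units_def by blast
qed

text \<open>Factorizations of \<open>x\<close> map forward by the homomorphism, those of
  \<open>f x\<close> lift back by \<open>factorization\<close>, and \<open>Units_iff\<close> matches
  the units.\<close>

lemma monoid_atom_iff:
  assumes x: "x \<in> carrier N"
  shows "monoid_atom M (f x) \<longleftrightarrow> monoid_atom N x"
proof
  assume L: "monoid_atom M (f x)"
  have "y \<in> Units N \<or> z \<in> Units N"
    if "y \<in> carrier N" "z \<in> carrier N" "x = y \<otimes>\<^bsub>N\<^esub> z" for y z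
    using L that unfolding monoid_atom_def
    by (metis Units_iff map_closed map_mult)
  then show "monoid_atom N x" using L x unfolding monoid_atom_def by (auto simp: Units_iff)
next
  assume R: "monoid_atom N x"
  have "u \<in> Units M \<or> v \<in> Units M"
    if "u \<in> carrier M" "v \<in> carrier M" "f x = u \<otimes>\<^bsub>M\<^esub> v" for u v
    using that(1,2) x that(3)
  proof (rule factorization)
    fix y z assume "y \<in> carrier N" "z \<in> carrier N" "u = f y" "v = f z" "x = y \<otimes>\<^bsub>N\<^esub> z"
    then show ?thesis using R unfolding monoid_atom_def by (auto simp: Units_iff)
  qed
  then show "monoid_atom M (f x)"
    using R x unfolding monoid_atom_def by (auto simp: Units_iff map_closed)
qed

lemma atom_products_map: "x \<in> atom_products N \<Longrightarrow> f x \<in> atom_products M"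
proof (induction rule: atom_products_induct)
  case one
  then show ?case by (simp add: map_one one_in_atom_products)
next
  case (Cons a y)
  then show ?case
    by (simp add: map_mult monoid_atom_carrier N.atom_products_carrier atom_products_Cons
        monoid_atom_iff)
qed

lemma atom_products_reflect:
  assumes "f x \<in> atom_products M" "x \<in> carrier N"
  shows "x \<in> atom_products N"
proof -
  \<comment> \<open>The product is decoupled from \<open>f x\<close>: once an atom is split off, the
    remaining factor is the image of a different element of \<open>N\<close>.\<close>
  have "x \<in> atom_products N" if "u \<in> atom_products M" "u = f x" "x \<in> carrier N" for u x
    using that
  proof (induction arbitrary: x rule: atom_products_induct)
    case one
    then have "x = \<one>\<^bsub>N\<^esub>" by (metis map_eq_iff map_one N.one_closed)
    then show ?case by (simp add: one_in_atom_products)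
  next
    case (Cons a v)
    from Cons.hyps(1) M.atom_products_carrier[OF Cons.hyps(2)] Cons.prems
    obtain y z where "y \<in> carrier N" "z \<in> carrier N" "a = f y" "v = f z" "x = y \<otimes>\<^bsub>N\<^esub> z"
      using factorization[of a v x] monoid_atom_carrier[of M a] by metis
    then show ?case using Cons by (auto simp: monoid_atom_iff intro!: atom_products_Cons)
  qed
  then show ?thesis using assms by blast
qed

lemma atomic_reflect: "atomic_monoid M \<Longrightarrow> atomic_monoid N"
  unfolding atomic_monoid_iff using atom_products_reflect map_closed Units_iff by blast

end

section \<open>Triangular matrices\<close>

lemma sum_eq_zero_imp_zero:
  fixes g :: "'b \<Rightarrow> 'a::information_semialgebra"
  assumes "finite A" "sum g A = 0" "x \<in> A"
  shows "g x = 0"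
  using assms by (auto simp: sum.remove[of A x] dest: add_invertible_imp_zero)

lemma Units_additive: "Units (additive_monoid :: 'a::information_semialgebra monoid) = {0}"
  by (auto simp: Units_def additive_monoid_def dest: add_invertible_imp_zero)

lemma reduced_mult_eq_one:
  fixes a b :: "'a::information_semialgebra"
  assumes "reduced_semialgebra TYPE('a)" "a * b = 1"
  shows "a = 1 \<and> b = 1"
proof -
  have "a \<in> Units nonzero_monoid" "b \<in> Units nonzero_monoid"
    using assms(2) by (auto simp: Units_def nonzero_monoid_def mult.commute)
  then show ?thesis using assms(1) by (simp add: reduced_semialgebra_def)
qed

text \<open>In the sum for the entry, terms with \<open>k < i\<close> vanish because
  \<open>A\<close> is upper triangular, those with \<open>k > i\<close> because \<open>B\<close>
  is.\<close>

lemma triangular_mult_diag: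
  assumes "A \<in> carrier_mat n n" "upper_triangular A" "B \<in> carrier_mat n n" "upper_triangular B"
    "i < n"
  shows "(A * B) $$ (i, i) = A $$ (i, i) * (B $$ (i, i) :: 'a::information_semialgebra)"
proof -
  have "(\<Sum>k<n. A $$ (i, k) * B $$ (k, i)) = (\<Sum>k\<in>{i}. A $$ (i, k) * B $$ (k, i))"
  proof (rule sum.mono_neutral_right)
    show "\<forall>k\<in>{..<n} - {i}. A $$ (i, k) * B $$ (k, i) = 0"
    proof
      fix k assume "k \<in> {..<n} - {i}"
      then have "A $$ (i, k) = 0 \<or> B $$ (k, i) = 0"
        using assms upper_triangularD[of A k i] upper_triangularD[of B i k]
        by (cases "k < i") auto
      then show "A $$ (i, k) * B $$ (k, i) = 0" by auto
    qed
  qed (use assms in auto)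
  then show ?thesis using assms by (simp add: triangular_mult_index del: index_mult_mat)
qed

lemma triangular_bullet_simps:
  "mult (triangular_bullet n) = (*)" "one (triangular_bullet n) = 1\<^sub>m n"
  by (simp_all add: triangular_bullet_def triangular_monoid_def)

lemma unitriangular_monoid_simps:
  "mult (unitriangular_monoid n) = (*)" "one (unitriangular_monoid n) = 1\<^sub>m n"
  by (simp_all add: unitriangular_monoid_def triangular_bullet_simps)

lemma monoid_triangular_bullet:
  "monoid (triangular_bullet n :: 'a::information_semialgebra mat monoid)"
  by unfold_locales
    (auto simp: carrier_triangular_bullet triangular_bullet_simps upper_triangular_mult
      triangular_mult_diag assoc_mult_mat[of _ n n _ n _ n] simp del: index_mult_mat(1))

lemma monoid_unitriangular_monoid:
  "monoid (unitriangular_monoid n :: 'a::information_semialgebra mat monoid)"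
  by unfold_locales
    (auto simp: carrier_unitriangular_monoid unitriangular_monoid_simps upper_triangular_mult
      triangular_mult_diag assoc_mult_mat[of _ n n _ n _ n] simp del: index_mult_mat(1))

lemma carrier_unitriangular_subset:
  "carrier (unitriangular_monoid n) \<subseteq> carrier (triangular_bullet n)"
  by (auto simp: unitriangular_monoid_def)

text \<open>A vanishing sum has only vanishing terms. The terms for \<open>k = i\<close> and
  \<open>k = j\<close> pair the two entries in question with nonzero diagonal entries.\<close>

lemma triangular_bullet_mult_eq_zero:
  fixes A B :: "'a::information_semialgebra mat"
  assumes A: "A \<in> carrier (triangular_bullet n)" and B: "B \<in> carrier (triangular_bullet n)"
    and ij: "i < n" "j < n" and zero: "(A * B) $$ (i, j) = 0"
  shows "A $$ (i, j) = 0 \<and> B $$ (i, j) = 0"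
proof -
  have AB: "A \<in> carrier_mat n n" "B \<in> carrier_mat n n"
    and nz: "A $$ (i, i) \<noteq> 0" "B $$ (j, j) \<noteq> 0"
    using A B ij by (auto simp: carrier_triangular_bullet)
  have "A $$ (i, k) * B $$ (k, j) = 0" if "k < n" for k
    using zero that unfolding triangular_mult_index[OF AB ij]
    by (intro sum_eq_zero_imp_zero[of "{..<n}" "\<lambda>k. A $$ (i, k) * B $$ (k, j)"]) auto
  from this[of i] this[of j] show ?thesis using nz ij by auto
qed

section \<open>Elementary matrices\<close>

text \<open>As the entry is replaced rather than increased, \<open>i \<noteq> j\<close> gives
  transvections and \<open>i = j\<close> diagonal matrices, so one calculation serves both.\<close>

definition elementary_mat :: "nat \<Rightarrow> nat \<Rightarrow> nat \<Rightarrow> 'a \<Rightarrow> 'a::{zero,one} mat" where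
  "elementary_mat n i j a =
     mat n n (\<lambda>(r, c). if r = i \<and> c = j then a else if r = c then 1 else 0)"

lemma elementary_mat_carrier: "elementary_mat n i j a \<in> carrier_mat n n"
  by (simp add: elementary_mat_def)

lemma elementary_mat_index:
  "r < n \<Longrightarrow> c < n \<Longrightarrow>
    elementary_mat n i j a $$ (r, c) = (if r = i \<and> c = j then a else if r = c then 1 else 0)"
  by (simp add: elementary_mat_def)

lemma elementary_mat_eq_one:
  "a = (if i = j then 1 else 0) \<Longrightarrow> elementary_mat n i j a = 1\<^sub>m n"
  by (intro eq_matI) (auto simp: elementary_mat_def)

lemma elementary_mat_inj:
  assumes "i < n" "j < n" "elementary_mat n i j a = elementary_mat n i j b"
  shows "a = b"
  using arg_cong[OF assms(3), of "\<lambda>A. A $$ (i, j)"] assms(1,2) by (simp add: elementary_mat_index)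

lemma elementary_mat_in_triangular:
  fixes a :: "'a::information_semialgebra"
  assumes "i < j \<or> i = j \<and> a \<noteq> 0"
  shows "elementary_mat n i j a \<in> carrier (triangular_bullet n)"
  using assms by (auto simp: carrier_triangular_bullet elementary_mat_carrier elementary_mat_index
      elementary_mat_def upper_triangular_def)

lemma elementary_mat_in_unitriangular:
  fixes a :: "'a::information_semialgebra"
  assumes "i < j"
  shows "elementary_mat n i j a \<in> carrier (unitriangular_monoid n)"
  using assms by (auto simp: carrier_unitriangular_monoid elementary_mat_carrier
      elementary_mat_def upper_triangular_def)

text \<open>Right multiplication acts on column \<open>j\<close> by means of column
  \<open>i\<close>. If column \<open>i\<close> of \<open>A\<close> is zero off the diagonal, this
  affects the single entry \<open>(i, j)\<close>.\<close>

lemma mult_elementary_mat: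
  fixes A :: "'a::information_semialgebra mat"
  assumes A: "A \<in> carrier_mat n n" and ij: "i < n" "j < n"
    and col: "\<And>r. r < n \<Longrightarrow> r \<noteq> i \<Longrightarrow> A $$ (r, i) = 0"
  shows "A * elementary_mat n i j a =
    mat n n (\<lambda>(r, c). if r = i \<and> c = j
      then if i = j then A $$ (i, i) * a else A $$ (i, j) + A $$ (i, i) * a else A $$ (r, c))"
    (is "_ = ?R")
proof (rule eq_matI)
  fix r c assume "r < dim_row ?R" "c < dim_col ?R"
  then have rc: "r < n" "c < n" by auto
  have "(A * elementary_mat n i j a) $$ (r, c) =
      (\<Sum>k<n. A $$ (r, k) * (if k = i \<and> c = j then a else if k = c then 1 else 0))"
    using rc by (simp add: triangular_mult_index[OF A elementary_mat_carrier] elementary_mat_index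
        del: index_mult_mat)
  \<comment> \<open>Each term splits into the contribution of \<open>a\<close> and that of the ones
    on the diagonal; the latter is suppressed where \<open>a\<close> has replaced a one.\<close>
  also have "\<dots> = (\<Sum>k<n. (if k = i then if c = j then A $$ (r, i) * a else 0 else 0) +
      (if k = c then if i = c \<and> c = j then 0 else A $$ (r, c) else 0))"
    by (intro sum.cong) auto
  also have "\<dots> = (if c = j then A $$ (r, i) * a else 0) +
      (if i = c \<and> c = j then 0 else A $$ (r, c))"
    using rc ij by (simp add: sum.distrib)
  also have "\<dots> = ?R $$ (r, c)"
    using rc col[of r] by (auto simp: add.commute)
  finally show "(A * elementary_mat n i j a) $$ (r, c) = ?R $$ (r, c)" .
qed (use A in \<open>auto simp: elementary_mat_def\<close>)

text \<open>Column \<open>i\<close> of the left factor is zero off the diagonal, and for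
  \<open>i \<noteq> j\<close> its diagonal entry is 1, whence the sum instead of the
  product.\<close>

lemma elementary_mat_mult:
  fixes a b :: "'a::information_semialgebra"
  assumes "i < n" "j < n"
  shows "elementary_mat n i j a * elementary_mat n i j b =
    elementary_mat n i j (if i = j then a * b else a + b)"
  using assms
  by (subst mult_elementary_mat[OF elementary_mat_carrier])
    (auto simp: elementary_mat_def intro!: eq_matI)

text \<open>Away from \<open>(i, j)\<close> the product agrees with the identity. There a diagonal 1
  splits only as 1 times 1, since \<open>S\<close> is reduced, and an off-diagonal 0 forces 0 in
  both factors.\<close>

lemma elementary_mat_factors:
  fixes A B :: "'a::information_semialgebra mat"
  assumes red: "reduced_semialgebra TYPE('a)"
    and A: "A \<in> carrier (triangular_bullet n)" and B: "B \<in> carrier (triangular_bullet n)"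
    and AB: "A * B = elementary_mat n i j a"
  shows "A \<in> range (elementary_mat n i j) \<and> B \<in> range (elementary_mat n i j)"
proof -
  have car: "A \<in> carrier_mat n n" "B \<in> carrier_mat n n" "upper_triangular A" "upper_triangular B"
    using A B by (auto simp: carrier_triangular_bullet)
  have "A $$ (r, c) = (if r = c then 1 else 0) \<and> B $$ (r, c) = (if r = c then 1 else 0)"
    if rc: "r < n" "c < n" "\<not> (r = i \<and> c = j)" for r c
  proof (cases "r = c")
    case True
    then have "elementary_mat n i j a $$ (r, r) = 1"
      using rc by (auto simp: elementary_mat_index)
    then have "A $$ (r, r) * B $$ (r, r) = 1"
      using triangular_mult_diag[OF car(1,3,2,4) rc(1)] by (simp add: AB)
    then show ?thesis using reduced_mult_eq_one[OF red, of "A $$ (r, r)"] True by simp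
  next
    case False
    then have "(A * B) $$ (r, c) = 0" using rc by (auto simp: AB elementary_mat_index)
    then show ?thesis using triangular_bullet_mult_eq_zero[OF A B rc(1,2)] False by simp
  qed
  then have "A = elementary_mat n i j (A $$ (i, j))" "B = elementary_mat n i j (B $$ (i, j))"
    using car by (auto simp: elementary_mat_def intro!: eq_matI)
  then show ?thesis by blast
qed

section \<open>Embeddings by elementary matrices\<close>

lemma elementary_mat_embedding_additive:
  assumes red: "reduced_semialgebra TYPE('a::information_semialgebra)" and ij: "i < j" "j < n"
  shows "divisor_closed_embedding additive_monoid (triangular_bullet n)
    (elementary_mat n i j :: 'a \<Rightarrow> _)"
proof -
  interpret N: comm_monoid "additive_monoid :: 'a monoid" by (rule comm_monoid_additive)
  interpret M: monoid "triangular_bullet n :: 'a mat monoid" by (rule monoid_triangular_bullet)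
  show ?thesis
    using ij elementary_mat_factors[OF red, of _ n _ i j]
    by unfold_locales
      (auto simp: hom_def additive_monoid_def triangular_bullet_simps elementary_mat_mult
        elementary_mat_in_triangular elementary_mat_eq_one
        intro!: inj_onI dest: elementary_mat_inj[rotated 2])
qed

lemma elementary_mat_embedding_unitriangular:
  assumes red: "reduced_semialgebra TYPE('a::information_semialgebra)" and ij: "i < j" "j < n"
  shows "divisor_closed_embedding additive_monoid (unitriangular_monoid n)
    (elementary_mat n i j :: 'a \<Rightarrow> _)"
proof -
  interpret N: comm_monoid "additive_monoid :: 'a monoid" by (rule comm_monoid_additive)
  interpret M: monoid "unitriangular_monoid n :: 'a mat monoid"
    by (rule monoid_unitriangular_monoid)
  show ?thesis
    \<comment> \<open>Factors of unitriangular matrices are handled inside the larger monoid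
      \<open>triangular_bullet n\<close>.\<close>
    using ij elementary_mat_factors[OF red carrier_unitriangular_subset[THEN subsetD]
        carrier_unitriangular_subset[THEN subsetD], of _ n _ i j]
    by unfold_locales
      (auto simp: hom_def additive_monoid_def unitriangular_monoid_simps elementary_mat_mult
        elementary_mat_in_unitriangular elementary_mat_eq_one
        intro!: inj_onI dest: elementary_mat_inj[rotated 2])
qed

lemma elementary_mat_embedding_nonzero:
  assumes red: "reduced_semialgebra TYPE('a::information_semialgebra)" and i: "i < n"
  shows "divisor_closed_embedding nonzero_monoid (triangular_bullet n)
    (elementary_mat n i i :: 'a \<Rightarrow> _)"
proof -
  interpret N: comm_monoid "nonzero_monoid :: 'a monoid" by (rule comm_monoid_nonzero)
  interpret M: monoid "triangular_bullet n :: 'a mat monoid" by (rule monoid_triangular_bullet)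
  \<comment> \<open>The result on factors allows any parameter in \<open>S\<close>; here it is a
    diagonal entry of a cancellable matrix, hence nonzero.\<close>
  have "A \<in> elementary_mat n i i ` carrier nonzero_monoid"
    if "A \<in> carrier (triangular_bullet n)" "A \<in> range (elementary_mat n i i)" for A :: "'a mat"
    using that i by (auto simp: carrier_triangular_bullet nonzero_monoid_def elementary_mat_index)
  moreover have "elementary_mat n i i \<in> hom nonzero_monoid (triangular_bullet n :: 'a mat monoid)"
    using i by (auto simp: hom_def nonzero_monoid_def triangular_bullet_simps elementary_mat_mult
        elementary_mat_in_triangular)
  moreover have "inj_on (elementary_mat n i i :: 'a \<Rightarrow> _) (carrier nonzero_monoid)"
    using i by (auto intro!: inj_onI dest: elementary_mat_inj[rotated 2])
  moreover have "elementary_mat n i i \<one>\<^bsub>nonzero_monoid\<^esub> = \<one>\<^bsub>triangular_bullet n :: 'a mat monoid\<^esub>"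
    by (simp add: nonzero_monoid_def triangular_bullet_simps elementary_mat_eq_one)
  ultimately show ?thesis
    using elementary_mat_factors[OF red, of _ n _ i i]
    by unfold_locales (auto simp: triangular_bullet_simps)
qed

text \<open>Factorization into elementary matrices, put as an induction rule so that it serves both
  matrix monoids. The order of the factors lets each of them set exactly one entry.\<close>

lemma triangular_induct_elementary [consumes 2, case_names one mult elementary]:
  fixes A :: "'a::information_semialgebra mat"
  assumes A: "A \<in> carrier_mat n n" "upper_triangular A"
    and one: "P (1\<^sub>m n)"
    and mult: "\<And>X Y. P X \<Longrightarrow> P Y \<Longrightarrow> P (X * Y)"
    and elementary: "\<And>i j. i \<le> j \<Longrightarrow> j < n \<Longrightarrow> P (elementary_mat n i j (A $$ (i, j)))"
  shows "P A"
proof -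
  have lower: "A $$ (i, j) = 0" if "j < i" "i < n" for i j
    using A that upper_triangularD[of A j i] by auto
  \<comment> \<open>The columns after \<open>m\<close> and the rows from \<open>r\<close> on of column \<open>m\<close> are already filled in.\<close>
  define C where "C m r = mat n n (\<lambda>(i, j). if m < j \<or> j = m \<and> r \<le> i then A $$ (i, j)
      else if i = j then 1 else 0)" for m r
  have fill: "P (C m 0)" if m: "m < n" and start: "P (C m (Suc m))" for m
  proof -
    have "P (C m r)" if "r \<le> Suc m" for r
      using that
    proof (induction rule: inc_induct)
      case base
      then show ?case by (rule start)
    next
      case (step r)
      \<comment> \<open>Column \<open>r\<close> of \<open>C m (Suc r)\<close> is still that of the
        identity: untouched if \<open>r < m\<close>, and filled only below the diagonal, with zeros,
        if \<open>r = m\<close>. So \<open>mult_elementary_mat\<close> applies and only the entry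
        \<open>(r, m)\<close> changes.\<close>
      have "C m (Suc r) * elementary_mat n r m (A $$ (r, m)) = C m r"
        using lower m step.hyps
        by (subst mult_elementary_mat) (auto simp: C_def Suc_le_eq intro!: eq_matI)
      moreover have "P (elementary_mat n r m (A $$ (r, m)))"
        using step.hyps m by (intro elementary) auto
      ultimately show ?case using mult[OF step.IH] by metis
    qed
    then show ?thesis by simp
  qed
  have "P (C m 0)" if "m \<le> n" for m
    using that
  proof (induction rule: inc_induct)
    case base
    have "C n 0 = 1\<^sub>m n" by (auto simp: C_def intro!: eq_matI)
    then show ?case using one by simp
  next
    case (step m)
    \<comment> \<open>Below the diagonal of column \<open>m\<close> both \<open>A\<close> and the
      identity vanish, so passing to the next column costs no factor.\<close>
    have "C m (Suc m) = C (Suc m) 0"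
      using lower by (auto simp: C_def Suc_le_eq intro!: eq_matI)
    then show ?case using fill step by simp
  qed
  moreover have "C 0 0 = A" using A by (auto simp: C_def intro!: eq_matI)
  ultimately show ?thesis by fastforce
qed

section \<open>Sufficiency of the atomicity conditions\<close>

lemma atomic_unitriangular_monoid:
  assumes red: "reduced_semialgebra TYPE('a::information_semialgebra)"
    and at: "atomic_monoid (additive_monoid :: 'a monoid)"
  shows "atomic_monoid (unitriangular_monoid n :: 'a mat monoid)"
proof -
  let ?U = "unitriangular_monoid n :: 'a mat monoid"
  interpret U: monoid ?U by (rule monoid_unitriangular_monoid)
  interpret add: comm_monoid "additive_monoid :: 'a monoid" by (rule comm_monoid_additive)
  have add: "a \<in> atom_products additive_monoid" for a :: 'a
    using add.atomic_imp_atom_products[OF at] Units_additive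
    by (auto simp: additive_monoid_def)
  have "A \<in> atom_products ?U" if A: "A \<in> carrier ?U" for A
  proof -
    have "A \<in> carrier_mat n n" "upper_triangular A"
      using A by (auto simp: carrier_unitriangular_monoid)
    then show ?thesis
    proof (induction rule: triangular_induct_elementary)
      case one
      then show ?case using one_in_atom_products[of ?U] by (simp add: unitriangular_monoid_simps)
    next
      case (mult X Y)
      then show ?case using U.atom_products_mult by (simp add: unitriangular_monoid_simps)
    next
      case (elementary i j)
      show ?case
      proof (cases "i = j")
        case True
        \<comment> \<open>Diagonal factors are trivial in the unitriangular case, which is why
          additive atomicity alone suffices.\<close>
        then have "elementary_mat n i j (A $$ (i, j)) = 1\<^sub>m n"
          using A elementary by (auto simp: carrier_unitriangular_monoid elementary_mat_eq_one)
        then show ?thesis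
          using one_in_atom_products[of ?U] by (simp add: unitriangular_monoid_simps)
      next
        case False
        interpret divisor_closed_embedding additive_monoid ?U "elementary_mat n i j"
          using red False elementary by (intro elementary_mat_embedding_unitriangular) auto
        show ?thesis using add by (rule atom_products_map)
      qed
    qed
  qed
  then show ?thesis by (auto simp: atomic_monoid_iff)
qed

text \<open>Multiplicative atomicity decomposes the diagonal factors, additive atomicity those above
  the diagonal.\<close>

lemma atomic_triangular_bullet:
  assumes red: "reduced_semialgebra TYPE('a::information_semialgebra)"
    and at: "bi_atomic TYPE('a)"
  shows "atomic_monoid (triangular_bullet n :: 'a mat monoid)"
proof -
  let ?T = "triangular_bullet n :: 'a mat monoid"
  interpret T: monoid ?T by (rule monoid_triangular_bullet)
  interpret add: comm_monoid "additive_monoid :: 'a monoid" by (rule comm_monoid_additive)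
  interpret nz: comm_monoid "nonzero_monoid :: 'a monoid" by (rule comm_monoid_nonzero)
  have add: "a \<in> atom_products additive_monoid" for a :: 'a
    using at add.atomic_imp_atom_products Units_additive
    by (auto simp: additive_monoid_def bi_atomic_def)
  have nz: "a \<in> atom_products nonzero_monoid" if "a \<noteq> 0" for a :: 'a
    using at nz.atomic_imp_atom_products[of a] red that
    by (auto simp: nonzero_monoid_def bi_atomic_def reduced_semialgebra_def)
  have "A \<in> atom_products ?T" if A: "A \<in> carrier ?T" for A
  proof -
    have "A \<in> carrier_mat n n" "upper_triangular A"
      using A by (auto simp: carrier_triangular_bullet)
    then show ?thesis
    proof (induction rule: triangular_induct_elementary)
      case one
      then show ?case using one_in_atom_products[of ?T] by (simp add: triangular_bullet_simps)
    next
      case (mult X Y)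
      then show ?case using T.atom_products_mult by (simp add: triangular_bullet_simps)
    next
      case (elementary i j)
      show ?case
      proof (cases "i = j")
        case True
        interpret divisor_closed_embedding nonzero_monoid ?T "elementary_mat n j j"
          using red elementary by (intro elementary_mat_embedding_nonzero) auto
        have "A $$ (j, j) \<noteq> 0" using A elementary by (auto simp: carrier_triangular_bullet)
        then show ?thesis using True nz by (simp add: atom_products_map)
      next
        case False
        interpret divisor_closed_embedding additive_monoid ?T "elementary_mat n i j"
          using red False elementary by (intro elementary_mat_embedding_additive) auto
        show ?thesis using add by (rule atom_products_map)
      qed
    qed
  qed
  then show ?thesis by (auto simp: atomic_monoid_iff)
qed

section \<open>Necessity and the equivalences\<close>

theorem theorem4p3:
  assumes reduced: "reduced_semialgebra TYPE('a::information_semialgebra)"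
  shows
    "(((\<forall>n\<ge>2. atomic_monoid (unitriangular_monoid n :: 'a mat monoid)) \<longleftrightarrow>
       (\<exists>n\<ge>2. atomic_monoid (unitriangular_monoid n :: 'a mat monoid))) \<and>
      ((\<exists>n\<ge>2. atomic_monoid (unitriangular_monoid n :: 'a mat monoid)) \<longleftrightarrow>
       atomic_monoid (additive_monoid :: 'a monoid)))
     \<and>
     (((\<forall>n\<ge>2. atomic_monoid (triangular_bullet n :: 'a mat monoid)) \<longleftrightarrow>
       (\<exists>n\<ge>2. atomic_monoid (triangular_bullet n :: 'a mat monoid))) \<and>
      ((\<exists>n\<ge>2. atomic_monoid (triangular_bullet n :: 'a mat monoid)) \<longleftrightarrow>
       bi_atomic TYPE('a)))"
proof -
  have "atomic_monoid (additive_monoid :: 'a monoid)"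
    if n: "n \<ge> 2" and at: "atomic_monoid (unitriangular_monoid n :: 'a mat monoid)" for n
  proof -
    \<comment> \<open>The position \<open>(0, 1)\<close> above the diagonal exists because
      \<open>n \<ge> 2\<close>.\<close>
    interpret divisor_closed_embedding "additive_monoid :: 'a monoid" "unitriangular_monoid n"
      "elementary_mat n 0 1"
      using n by (intro elementary_mat_embedding_unitriangular reduced) auto
    show ?thesis using at by (rule atomic_reflect)
  qed
  moreover have "bi_atomic TYPE('a)"
    if n: "n \<ge> 2" and at: "atomic_monoid (triangular_bullet n :: 'a mat monoid)" for n
  proof -
    interpret add: divisor_closed_embedding "additive_monoid :: 'a monoid" "triangular_bullet n"
      "elementary_mat n 0 1"
      using n by (intro elementary_mat_embedding_additive reduced) auto
    interpret nz: divisor_closed_embedding "nonzero_monoid :: 'a monoid" "triangular_bullet n"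
      "elementary_mat n 0 0"
      using n by (intro elementary_mat_embedding_nonzero reduced) auto
    show ?thesis
      using add.atomic_reflect[OF at] nz.atomic_reflect[OF at] by (simp add: bi_atomic_def)
  qed
  \<comment> \<open>Atomicity for a single \<open>n \<ge> 2\<close> yields the condition on
    \<open>S\<close>, which in turn yields atomicity for all \<open>n\<close>.\<close>
  ultimately show ?thesis
    using atomic_unitriangular_monoid[OF reduced] atomic_triangular_bullet[OF reduced]
    by (intro conjI iffI) blast+
qed

end
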